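(* Let $X$ be a complex Banach space and let $T\in B(X)$. If $T$ has the decomposition property $(\delta)$ and $K\in B(X)$ is an algebraic operator which commutes with $T$, then $T+K$ has the decomposition property $(\delta)$.
   Context: $B(X)$ is the Banach algebra of bounded linear operators on $X$. For a Banach space $Y$ and open $U\subset\mathbb{C}$, $O(U;Y)$ is the Fréchet space of analytic $Y$-valued functions on $U$, with the topology of uniform convergence on compact subsets of $U$; $D(\lambda_0;v)$ is the open disc with centre $\lambda_0$ and radius $v$. An operator $A\in B(Y)$ has Bishop's property $(\beta)$ at $\lambda_0\in\mathbb{C}$ if there exists $v>0$ such that for every open subset $U\subset D(\lambda_0;v)$ and every sequence $(f_n)_{n\ge 1}\subset O(U;Y)$, $\lim_{n\to\infty}(A-\lambda I)f_n(\lambda)=0$ in $O(U;Y)$ implies $\lim_{n\to\infty}f_n(\lambda)=0$ in $O(U;Y)$. $A$ has Bishop's property $(\beta)$ if it has it at every $\lambda_0\in\mathbb{C}$. An operator $T\in B(X)$ has the decomposition property $(\delta)$ if its dual (adjoint) operator $T^*$ on the dual space $X^*$ has Bishop's property $(\beta)$. An operator $K\in B(X)$ is algebraic if there is a nonzero complex polynomial $p$ with $p(K)=0$. *)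

theory Defs
  imports "HOL-Analysis.Analysis" "HOL-Computational_Algebra.Polynomial"
begin

section \<open>Complex Banach spaces\<close>

class complex_normed_vector = real_normed_vector +
  fixes scaleC :: "complex \<Rightarrow> 'a \<Rightarrow> 'a"  (infixr "*\<^sub>C" 75)
  assumes scaleC_add_right: "a *\<^sub>C (x + y) = a *\<^sub>C x + a *\<^sub>C y"
    and scaleC_add_left: "(a + b) *\<^sub>C x = a *\<^sub>C x + b *\<^sub>C x"
    and scaleC_scaleC: "a *\<^sub>C b *\<^sub>C x = (a * b) *\<^sub>C x"
    and scaleR_scaleC: "r *\<^sub>R x = complex_of_real r *\<^sub>C x"
    and norm_scaleC: "norm (a *\<^sub>C x) = cmod a * norm x"

class complex_banach = complex_normed_vector + banach

instantiation complex :: complex_banach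
begin

definition scaleC_complex :: "complex \<Rightarrow> complex \<Rightarrow> complex"
  where "scaleC_complex a x = a * x"

instance
  by standard (auto simp: scaleC_complex_def algebra_simps norm_mult scaleR_conv_of_real)

end

lemma bounded_linear_scaleC_right: "bounded_linear (\<lambda>x::'a::complex_normed_vector. c *\<^sub>C x)"
proof (rule bounded_linear_intro[where K = "cmod c"])
  show "c *\<^sub>C (x + y) = c *\<^sub>C x + c *\<^sub>C y" for x y :: 'a
    by (rule scaleC_add_right)
  show "c *\<^sub>C (r *\<^sub>R x) = r *\<^sub>R (c *\<^sub>C x)" for r and x :: 'a
    by (simp add: scaleR_scaleC scaleC_scaleC mult.commute)
  show "norm (c *\<^sub>C x) \<le> norm x * cmod c" for x :: 'a
    by (simp add: norm_scaleC mult.commute)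
qed

lemma scaleC_zero_right [simp]: "c *\<^sub>C (0::'a::complex_normed_vector) = 0"
  using bounded_linear_scaleC_right linear_simps(3) by blast

lemma scaleC_minus_right: "c *\<^sub>C (- x) = - (c *\<^sub>C (x::'a::complex_normed_vector))"
  by (metis linear_simps(4) bounded_linear_scaleC_right)

lemma scaleC_diff_right: "c *\<^sub>C (x - y) = c *\<^sub>C x - c *\<^sub>C (y::'a::complex_normed_vector)"
  by (metis linear_simps(2) bounded_linear_scaleC_right)


section \<open>Bounded complex-linear operators\<close>

definition bounded_clinear :: "('a::complex_normed_vector \<Rightarrow> 'b::complex_normed_vector) \<Rightarrow> bool"
  where "bounded_clinear f \<longleftrightarrow> bounded_linear f \<and> (\<forall>c x. f (c *\<^sub>C x) = c *\<^sub>C f x)"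

typedef (overloaded) ('a, 'b) cblinfun ("(_ \<Rightarrow>\<^sub>C\<^sub>L /_)" [22, 21] 21) =
  "{f :: 'a::complex_normed_vector \<Rightarrow> 'b::complex_normed_vector. bounded_clinear f}"
  morphisms cblinfun_apply Cblinfun
proof
  show "(\<lambda>x. 0) \<in> {f :: 'a \<Rightarrow> 'b. bounded_clinear f}"
    by (simp add: bounded_clinear_def)
qed

setup_lifting type_definition_cblinfun

lemma bounded_linear_cblinfun: "bounded_linear (cblinfun_apply f)"
  using cblinfun_apply[of f] by (simp add: bounded_clinear_def)

lemma cblinfun_scaleC: "cblinfun_apply f (c *\<^sub>C x) = c *\<^sub>C cblinfun_apply f x"
  using cblinfun_apply[of f] by (simp add: bounded_clinear_def)

lemma cblinfun_eqI: "(\<And>x. cblinfun_apply f x = cblinfun_apply g x) \<Longrightarrow> f = g"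
  by (simp add: cblinfun_apply_inject[symmetric] ext)

instantiation cblinfun :: (complex_normed_vector, complex_normed_vector) complex_normed_vector
begin

lift_definition zero_cblinfun :: "'a \<Rightarrow>\<^sub>C\<^sub>L 'b" is "\<lambda>x. 0"
  by (simp add: bounded_clinear_def)

lift_definition plus_cblinfun :: "'a \<Rightarrow>\<^sub>C\<^sub>L 'b \<Rightarrow> 'a \<Rightarrow>\<^sub>C\<^sub>L 'b \<Rightarrow> 'a \<Rightarrow>\<^sub>C\<^sub>L 'b"
  is "\<lambda>f g x. f x + g x"
  by (simp add: bounded_clinear_def bounded_linear_add scaleC_add_right)

lift_definition minus_cblinfun :: "'a \<Rightarrow>\<^sub>C\<^sub>L 'b \<Rightarrow> 'a \<Rightarrow>\<^sub>C\<^sub>L 'b \<Rightarrow> 'a \<Rightarrow>\<^sub>C\<^sub>L 'b"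
  is "\<lambda>f g x. f x - g x"
  by (simp add: bounded_clinear_def bounded_linear_sub scaleC_diff_right)

lift_definition uminus_cblinfun :: "'a \<Rightarrow>\<^sub>C\<^sub>L 'b \<Rightarrow> 'a \<Rightarrow>\<^sub>C\<^sub>L 'b" is "\<lambda>f x. - f x"
  by (simp add: bounded_clinear_def bounded_linear_minus scaleC_minus_right)

lift_definition scaleC_cblinfun :: "complex \<Rightarrow> 'a \<Rightarrow>\<^sub>C\<^sub>L 'b \<Rightarrow> 'a \<Rightarrow>\<^sub>C\<^sub>L 'b"
  is "\<lambda>c f x. c *\<^sub>C f x"
  by (auto simp: bounded_clinear_def scaleC_scaleC mult.commute
      intro: bounded_linear_compose[OF bounded_linear_scaleC_right])

lift_definition scaleR_cblinfun :: "real \<Rightarrow> 'a \<Rightarrow>\<^sub>C\<^sub>L 'b \<Rightarrow> 'a \<Rightarrow>\<^sub>C\<^sub>L 'b"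
  is "\<lambda>r f x. r *\<^sub>R f x"
  by (auto simp: bounded_clinear_def scaleR_scaleC scaleC_scaleC mult.commute
      intro: bounded_linear_compose[OF bounded_linear_scaleC_right])

lift_definition norm_cblinfun :: "'a \<Rightarrow>\<^sub>C\<^sub>L 'b \<Rightarrow> real" is onorm .

definition sgn_cblinfun :: "'a \<Rightarrow>\<^sub>C\<^sub>L 'b \<Rightarrow> 'a \<Rightarrow>\<^sub>C\<^sub>L 'b"
  where "sgn_cblinfun f = scaleR (inverse (norm f)) f"

definition dist_cblinfun :: "'a \<Rightarrow>\<^sub>C\<^sub>L 'b \<Rightarrow> 'a \<Rightarrow>\<^sub>C\<^sub>L 'b \<Rightarrow> real"
  where "dist_cblinfun f g = norm (f - g)"

definition uniformity_cblinfun :: "(('a \<Rightarrow>\<^sub>C\<^sub>L 'b) \<times> ('a \<Rightarrow>\<^sub>C\<^sub>L 'b)) filter"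
  where "uniformity_cblinfun = (INF e\<in>{0 <..}. principal {(x, y). dist x y < e})"

definition open_cblinfun :: "('a \<Rightarrow>\<^sub>C\<^sub>L 'b) set \<Rightarrow> bool"
  where "open_cblinfun S \<longleftrightarrow> (\<forall>x\<in>S. \<forall>\<^sub>F (x', y) in uniformity. x' = x \<longrightarrow> y \<in> S)"

instance
proof
  fix f g h :: "'a \<Rightarrow>\<^sub>C\<^sub>L 'b" and a b :: complex and r s :: real
  show "f + g + h = f + (g + h)" "f + g = g + f" "0 + f = f" "- f + f = 0" "f - g = f + - g"
    by (transfer; simp add: fun_eq_iff algebra_simps)+
  show "r *\<^sub>R (f + g) = r *\<^sub>R f + r *\<^sub>R g" "(r + s) *\<^sub>R f = r *\<^sub>R f + s *\<^sub>R f"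
    "r *\<^sub>R s *\<^sub>R f = (r * s) *\<^sub>R f" "1 *\<^sub>R f = f"
    by (transfer; simp add: fun_eq_iff algebra_simps)+
  show "dist f g = norm (f - g)"
    by (rule dist_cblinfun_def)
  show "sgn f = scaleR (inverse (norm f)) f"
    by (rule sgn_cblinfun_def)
  show "(uniformity :: (('a \<Rightarrow>\<^sub>C\<^sub>L 'b) \<times> ('a \<Rightarrow>\<^sub>C\<^sub>L 'b)) filter) =
      (INF e\<in>{0 <..}. principal {(x, y). dist x y < e})"
    by (rule uniformity_cblinfun_def)
  show "open S \<longleftrightarrow> (\<forall>x\<in>S. \<forall>\<^sub>F (x', y) in uniformity. x' = x \<longrightarrow> y \<in> S)"
    for S :: "('a \<Rightarrow>\<^sub>C\<^sub>L 'b) set"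
    by (rule open_cblinfun_def)
  show "norm f = 0 \<longleftrightarrow> f = 0"
    by transfer (auto simp: bounded_clinear_def onorm_eq_0)
  show "norm (f + g) \<le> norm f + norm g"
    by transfer (simp add: bounded_clinear_def onorm_triangle)
  show "norm (r *\<^sub>R f) = \<bar>r\<bar> * norm f"
    by transfer (simp add: bounded_clinear_def onorm_scaleR)
  show "a *\<^sub>C (f + g) = a *\<^sub>C f + a *\<^sub>C g" "(a + b) *\<^sub>C f = a *\<^sub>C f + b *\<^sub>C f"
    "a *\<^sub>C b *\<^sub>C f = (a * b) *\<^sub>C f" "r *\<^sub>R f = complex_of_real r *\<^sub>C f"
    by (transfer; simp add: fun_eq_iff scaleC_add_right scaleC_add_left scaleC_scaleC scaleR_scaleC)+
  show "norm (a *\<^sub>C f) = cmod a * norm f"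
  proof transfer
    fix a :: complex and f :: "'a \<Rightarrow> 'b"
    assume "bounded_clinear f"
    moreover have "onorm (\<lambda>x. a *\<^sub>C f x) = onorm (\<lambda>x. cmod a *\<^sub>R f x)"
      by (simp add: onorm_def norm_scaleC)
    ultimately show "onorm (\<lambda>x. a *\<^sub>C f x) = cmod a * onorm f"
      by (simp add: bounded_clinear_def onorm_scaleR)
  qed
qed

end

lemma norm_cblinfun_apply_le: "norm (cblinfun_apply f x) \<le> norm f * norm x"
  by transfer (simp add: bounded_clinear_def onorm)

lemma norm_cblinfun_le:
  "(\<And>x. norm (cblinfun_apply f x) \<le> b * norm x) \<Longrightarrow> 0 \<le> b \<Longrightarrow> norm f \<le> b"
  by transfer (simp add: onorm_bound)

instance cblinfun :: (complex_normed_vector, complex_banach) complex_banach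
proof
  fix X :: "nat \<Rightarrow> 'a \<Rightarrow>\<^sub>C\<^sub>L 'b"
  assume "Cauchy X"
  define B where "B f = Blinfun (cblinfun_apply f)" for f :: "'a \<Rightarrow>\<^sub>C\<^sub>L 'b"
  have B: "blinfun_apply (B f) = cblinfun_apply f" for f
    by (simp add: B_def bounded_linear_Blinfun_apply bounded_linear_cblinfun)
  have dB: "dist (B f) (B g) = dist f g" for f g
  proof -
    have "blinfun_apply (B f - B g) = cblinfun_apply (f - g)"
      by (simp add: fun_eq_iff blinfun.diff_left B minus_cblinfun.rep_eq)
    then show ?thesis
      by (simp add: dist_norm norm_blinfun.rep_eq norm_cblinfun.rep_eq)
  qed
  from \<open>Cauchy X\<close> have "Cauchy (\<lambda>n. B (X n))"
    by (simp add: Cauchy_def dB)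
  then obtain L where L: "(\<lambda>n. B (X n)) \<longlonglongrightarrow> L"
    by (auto simp: Cauchy_convergent_iff convergent_def)
  have lim: "(\<lambda>n. cblinfun_apply (X n) x) \<longlonglongrightarrow> blinfun_apply L x" for x
    using blinfun.tendsto[OF L tendsto_const[of x]] by (simp add: B)
  have "bounded_clinear (blinfun_apply L)"
    unfolding bounded_clinear_def
  proof (intro conjI allI)
    show "bounded_linear (blinfun_apply L)"
      by (rule blinfun.bounded_linear_right)
    fix c x
    have "(\<lambda>n. c *\<^sub>C cblinfun_apply (X n) x) \<longlonglongrightarrow> c *\<^sub>C blinfun_apply L x"
      by (rule bounded_linear.tendsto[OF bounded_linear_scaleC_right lim])
    then show "blinfun_apply L (c *\<^sub>C x) = c *\<^sub>C blinfun_apply L x"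
      using lim[of "c *\<^sub>C x"] by (simp add: cblinfun_scaleC LIMSEQ_unique)
  qed
  then have "cblinfun_apply (Cblinfun (blinfun_apply L)) = blinfun_apply L"
    by (simp add: Cblinfun_inverse)
  then have "B (Cblinfun (blinfun_apply L)) = L"
    by (simp add: B_def blinfun_apply_inverse)
  then have "dist (B (X n)) L = dist (X n) (Cblinfun (blinfun_apply L))" for n
    using dB[of "X n" "Cblinfun (blinfun_apply L)"] by simp
  then have "X \<longlonglongrightarrow> Cblinfun (blinfun_apply L)"
    using L by (simp add: tendsto_dist_iff[of _ L] tendsto_dist_iff[of X])
  then show "convergent X"
    by (auto simp: convergent_def)
qed

lift_definition id_cblinfun :: "'a::complex_normed_vector \<Rightarrow>\<^sub>C\<^sub>L 'a" is "\<lambda>x. x"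
  by (simp add: bounded_clinear_def)

lift_definition cblinfun_compose ::
  "'b::complex_normed_vector \<Rightarrow>\<^sub>C\<^sub>L 'c::complex_normed_vector \<Rightarrow>
   'a::complex_normed_vector \<Rightarrow>\<^sub>C\<^sub>L 'b \<Rightarrow> 'a \<Rightarrow>\<^sub>C\<^sub>L 'c"  (infixl "o\<^sub>C\<^sub>L" 67)
  is "\<lambda>f g x. f (g x)"
  by (simp add: bounded_clinear_def bounded_linear_compose)

lemma norm_cblinfun_compose: "norm (f o\<^sub>C\<^sub>L g) \<le> norm f * norm g"
  by transfer (simp add: bounded_clinear_def onorm_compose[unfolded comp_def])


section \<open>Algebraic operators and adjoints\<close>

primrec cblinfun_power :: "'a::complex_normed_vector \<Rightarrow>\<^sub>C\<^sub>L 'a \<Rightarrow> nat \<Rightarrow> 'a \<Rightarrow>\<^sub>C\<^sub>L 'a" where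
  "cblinfun_power K 0 = id_cblinfun"
| "cblinfun_power K (Suc n) = K o\<^sub>C\<^sub>L cblinfun_power K n"

definition poly_cblinfun :: "complex poly \<Rightarrow> 'a::complex_normed_vector \<Rightarrow>\<^sub>C\<^sub>L 'a \<Rightarrow> 'a \<Rightarrow>\<^sub>C\<^sub>L 'a"
  where "poly_cblinfun p K = (\<Sum>i\<le>degree p. coeff p i *\<^sub>C cblinfun_power K i)"

definition algebraic_operator :: "'a::complex_normed_vector \<Rightarrow>\<^sub>C\<^sub>L 'a \<Rightarrow> bool"
  where "algebraic_operator K \<longleftrightarrow> (\<exists>p. p \<noteq> 0 \<and> poly_cblinfun p K = 0)"

text \<open>The Banach space adjoint, acting on the dual space by precomposition; it is linear
  (not conjugate-linear) in the operator.\<close>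

lift_definition adjoint_cblinfun ::
  "'a::complex_normed_vector \<Rightarrow>\<^sub>C\<^sub>L 'b::complex_normed_vector \<Rightarrow>
   ('b \<Rightarrow>\<^sub>C\<^sub>L complex) \<Rightarrow>\<^sub>C\<^sub>L ('a \<Rightarrow>\<^sub>C\<^sub>L complex)"
  is "\<lambda>(T :: 'a \<Rightarrow>\<^sub>C\<^sub>L 'b) (\<phi> :: 'b \<Rightarrow>\<^sub>C\<^sub>L complex). \<phi> o\<^sub>C\<^sub>L T"
  unfolding bounded_clinear_def
proof (intro conjI allI bounded_linear_intro)
  fix T :: "'a \<Rightarrow>\<^sub>C\<^sub>L 'b" and \<phi> \<psi> :: "'b \<Rightarrow>\<^sub>C\<^sub>L complex" and r :: real and c :: complex
  show "(\<phi> + \<psi>) o\<^sub>C\<^sub>L T = (\<phi> o\<^sub>C\<^sub>L T) + (\<psi> o\<^sub>C\<^sub>L T)"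
    "(r *\<^sub>R \<phi>) o\<^sub>C\<^sub>L T = r *\<^sub>R (\<phi> o\<^sub>C\<^sub>L T)"
    "(c *\<^sub>C \<phi>) o\<^sub>C\<^sub>L T = c *\<^sub>C (\<phi> o\<^sub>C\<^sub>L T)"
    by (transfer; simp)+
  show "norm (\<phi> o\<^sub>C\<^sub>L T) \<le> norm \<phi> * norm T"
    by (rule norm_cblinfun_compose)
qed


section \<open>Property \<open>(\<beta>)\<close> and the decomposition property \<open>(\<delta>)\<close>\<close>

text \<open>Analyticity on an open set is complex differentiability, in norm, at every point. Functions
  are total, but only their values on \<open>U\<close> matter.\<close>

definition vector_analytic_on :: "(complex \<Rightarrow> 'a::complex_normed_vector) \<Rightarrow> complex set \<Rightarrow> bool"
    (infixl "vector'_analytic'_on" 50)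
  where "f vector_analytic_on U \<longleftrightarrow>
    (\<forall>z\<in>U. \<exists>D. (f has_derivative (\<lambda>h. h *\<^sub>C D)) (at z))"

definition compactly_tendsto_zero ::
    "complex set \<Rightarrow> (nat \<Rightarrow> complex \<Rightarrow> 'a::complex_normed_vector) \<Rightarrow> bool"
  where "compactly_tendsto_zero U f \<longleftrightarrow>
    (\<forall>C. compact C \<and> C \<subseteq> U \<longrightarrow> uniform_limit C f (\<lambda>_. 0) sequentially)"

definition bishop_property_at :: "'a::complex_banach \<Rightarrow>\<^sub>C\<^sub>L 'a \<Rightarrow> complex \<Rightarrow> bool"
  where "bishop_property_at A z\<^sub>0 \<longleftrightarrow>
    (\<exists>v>0. \<forall>U (f :: nat \<Rightarrow> complex \<Rightarrow> 'a).
      open U \<and> U \<subseteq> ball z\<^sub>0 v \<and> (\<forall>n. f n vector_analytic_on U) \<longrightarrow>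
      compactly_tendsto_zero U (\<lambda>n z. cblinfun_apply (A - z *\<^sub>C id_cblinfun) (f n z)) \<longrightarrow>
      compactly_tendsto_zero U f)"

definition bishop_property :: "'a::complex_banach \<Rightarrow>\<^sub>C\<^sub>L 'a \<Rightarrow> bool"
  where "bishop_property A \<longleftrightarrow> (\<forall>z\<^sub>0. bishop_property_at A z\<^sub>0)"

definition decomposition_property :: "'a::complex_banach \<Rightarrow>\<^sub>C\<^sub>L 'a \<Rightarrow> bool"
  where "decomposition_property T \<longleftrightarrow> bishop_property (adjoint_cblinfun T)"

end

theory Submission
  imports Defs "HOL-Computational_Algebra.Fundamental_Theorem_Algebra"
begin

text \<open>
  Write \<open>A = T\<^sup>*\<close> and \<open>B = K\<^sup>*\<close>, so that \<open>A\<close> has property \<open>(\<beta>)\<close>, \<open>B\<close> commutes with \<open>A\<close> and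
  \<open>p(B) = 0\<close> for some \<open>p \<noteq> 0\<close>. Suppose \<open>(A + B - z) f\<^sub>n \<rightarrow> 0\<close>. Linear factors of \<open>p(B)\<close> can be
  stripped off one at a time: if \<open>q(B) (B - \<mu>) f\<^sub>n \<rightarrow> 0\<close>, then by induction on the degree, applied
  to \<open>(B - \<mu>) f\<^sub>n\<close>, also \<open>(B - \<mu>) f\<^sub>n \<rightarrow> 0\<close>; hence \<open>(A + \<mu> - z) f\<^sub>n \<rightarrow> 0\<close>, and \<open>f\<^sub>n \<rightarrow> 0\<close> because the
  translate \<open>A + \<mu>\<close> inherits property \<open>(\<beta>)\<close>.
\<close>

lemmas cblinfun_rep_eqs =
  zero_cblinfun.rep_eq plus_cblinfun.rep_eq minus_cblinfun.rep_eq scaleC_cblinfun.rep_eq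
  id_cblinfun.rep_eq cblinfun_compose.rep_eq

lemmas cblinfun_apply_linear = linear_simps[OF bounded_linear_cblinfun]

lemma scaleC_zero_left: "0 *\<^sub>C (x :: 'a::complex_normed_vector) = 0"
  using scaleC_add_left[of 0 0 x] by simp

section \<open>Analytic sequences, compact convergence and translation\<close>

lemma vector_analytic_on_cblinfun_apply:
  assumes "f vector_analytic_on U"
  shows "(\<lambda>z. cblinfun_apply S (f z)) vector_analytic_on U"
  unfolding vector_analytic_on_def
proof
  fix z assume "z \<in> U"
  then obtain D where "(f has_derivative (\<lambda>h. h *\<^sub>C D)) (at z)"
    using assms by (auto simp: vector_analytic_on_def)
  from bounded_linear.has_derivative[OF bounded_linear_cblinfun this, of S]
  show "\<exists>D. ((\<lambda>z. cblinfun_apply S (f z)) has_derivative (\<lambda>h. h *\<^sub>C D)) (at z)"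
    by (auto simp: cblinfun_scaleC)
qed

lemma vector_analytic_on_translate:
  assumes "f vector_analytic_on U"
  shows "(\<lambda>z. f (z + c)) vector_analytic_on (\<lambda>z. z - c) ` U"
  unfolding vector_analytic_on_def
proof
  fix z assume "z \<in> (\<lambda>z. z - c) ` U"
  then have "z + c \<in> U"
    by auto
  then obtain D where "(f has_derivative (\<lambda>h. h *\<^sub>C D)) (at (z + c))"
    using assms by (auto simp: vector_analytic_on_def)
  moreover have "((\<lambda>z. z + c) has_derivative (\<lambda>h. h)) (at z)"
    by (auto intro!: derivative_eq_intros)
  ultimately have "((\<lambda>z. f (z + c)) has_derivative (\<lambda>h. h *\<^sub>C D)) (at z)"
    by (rule has_derivative_compose[rotated])
  then show "\<exists>D. ((\<lambda>z. f (z + c)) has_derivative (\<lambda>h. h *\<^sub>C D)) (at z)" ..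
qed

lemma compactly_tendsto_zero_cblinfun_apply:
  assumes "compactly_tendsto_zero U f"
  shows "compactly_tendsto_zero U (\<lambda>n z. cblinfun_apply S (f n z))"
  unfolding compactly_tendsto_zero_def
proof (intro allI impI)
  fix C assume "compact C \<and> C \<subseteq> U"
  then have "uniform_limit C f (\<lambda>_. 0) sequentially"
    using assms by (simp add: compactly_tendsto_zero_def)
  from bounded_linear.uniform_limit[OF bounded_linear_cblinfun this, of S]
  show "uniform_limit C (\<lambda>n z. cblinfun_apply S (f n z)) (\<lambda>_. 0) sequentially"
    by (simp add: cblinfun_apply_linear)
qed

lemma compactly_tendsto_zero_diff:
  assumes "compactly_tendsto_zero U f" "compactly_tendsto_zero U g"
  shows "compactly_tendsto_zero U (\<lambda>n z. f n z - g n z)"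
  unfolding compactly_tendsto_zero_def
proof (intro allI impI)
  fix C assume C: "compact C \<and> C \<subseteq> U"
  have "uniform_limit C (\<lambda>n z. f n z - g n z) (\<lambda>_. 0 - 0) sequentially"
    by (rule uniform_limit_minus) (use assms C in \<open>simp_all add: compactly_tendsto_zero_def\<close>)
  then show "uniform_limit C (\<lambda>n z. f n z - g n z) (\<lambda>_. 0) sequentially"
    by simp
qed

lemma compactly_tendsto_zero_translate:
  "compactly_tendsto_zero ((\<lambda>z. z - c) ` U) (\<lambda>n z. f n (z + c)) \<longleftrightarrow> compactly_tendsto_zero U f"
proof -
  have shift: "compactly_tendsto_zero ((\<lambda>z. z - d) ` V) (\<lambda>n z. g n (z + d))"
    if "compactly_tendsto_zero V g" for d V and g :: "nat \<Rightarrow> complex \<Rightarrow> 'a"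
    unfolding compactly_tendsto_zero_def
  proof (intro allI impI)
    fix C assume C: "compact C \<and> C \<subseteq> (\<lambda>z. z - d) ` V"
    have "compact ((\<lambda>z. z + d) ` C)"
      using C by (intro compact_continuous_image continuous_intros) auto
    moreover have "(\<lambda>z. z + d) ` C \<subseteq> V"
      using C by auto
    ultimately have "uniform_limit ((\<lambda>z. z + d) ` C) g (\<lambda>_. 0) sequentially"
      using that by (simp add: compactly_tendsto_zero_def)
    then show "uniform_limit C (\<lambda>n z. g n (z + d)) (\<lambda>_. 0) sequentially"
      by (simp add: uniform_limit_iff)
  qed
  \<comment> \<open>The converse is \<open>shift\<close> by \<open>- c\<close> applied to the
    translated sequence; the two shifts cancel.\<close>
  show ?thesis
    using shift[of U f c] shift[of "(\<lambda>z. z - c) ` U" "\<lambda>n z. f n (z + c)" "- c"]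
    by (auto simp: image_image)
qed

text \<open>Substituting \<open>z + c\<close> for \<open>z\<close> turns \<open>A + c - z\<close>
  into \<open>A - z\<close> and moves the disc about \<open>z\<^sub>0\<close> to the disc of the
  same radius about \<open>z\<^sub>0 - c\<close>, so the radius for \<open>A\<close> serves
  unchanged.\<close>

lemma bishop_property_at_translate:
  assumes "bishop_property_at A (z\<^sub>0 - c)"
  shows "bishop_property_at (A + c *\<^sub>C id_cblinfun) z\<^sub>0"
proof -
  obtain v where v: "v > 0"
    and A: "\<And>U f. \<lbrakk>open U; U \<subseteq> ball (z\<^sub>0 - c) v; \<And>n. f n vector_analytic_on U;
        compactly_tendsto_zero U (\<lambda>n z. cblinfun_apply (A - z *\<^sub>C id_cblinfun) (f n z))\<rbrakk>
      \<Longrightarrow> compactly_tendsto_zero U f"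
    using assms unfolding bishop_property_at_def by blast
  show ?thesis
    unfolding bishop_property_at_def
  proof (intro exI[of _ v] conjI allI impI v; elim conjE)
    fix U and f :: "nat \<Rightarrow> complex \<Rightarrow> 'a"
    assume U: "open U" "U \<subseteq> ball z\<^sub>0 v" and f: "\<forall>n. f n vector_analytic_on U"
      and lim: "compactly_tendsto_zero U
        (\<lambda>n z. cblinfun_apply (A + c *\<^sub>C id_cblinfun - z *\<^sub>C id_cblinfun) (f n z))"
    have "compactly_tendsto_zero ((\<lambda>z. z - c) ` U) (\<lambda>n z. f n (z + c))"
    proof (rule A)
      show "open ((\<lambda>z. z - c) ` U)"
        using U(1) by (rule open_translation_subtract)
      show "(\<lambda>z. z - c) ` U \<subseteq> ball (z\<^sub>0 - c) v"
        using U(2) by (auto simp: dist_norm)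
      show "(\<lambda>z. f n (z + c)) vector_analytic_on (\<lambda>z. z - c) ` U" for n
        using f by (simp add: vector_analytic_on_translate)
      have eq: "A + c *\<^sub>C id_cblinfun - (z + c) *\<^sub>C id_cblinfun = A - z *\<^sub>C id_cblinfun" for z
        by (simp add: scaleC_add_left)
      show "compactly_tendsto_zero ((\<lambda>z. z - c) ` U)
          (\<lambda>n z. cblinfun_apply (A - z *\<^sub>C id_cblinfun) (f n (z + c)))"
        using lim compactly_tendsto_zero_translate[of c U
          "\<lambda>n z. cblinfun_apply (A + c *\<^sub>C id_cblinfun - z *\<^sub>C id_cblinfun) (f n z)"]
        by (simp only: eq)
    qed
    then show "compactly_tendsto_zero U f"
      by (simp add: compactly_tendsto_zero_translate)
  qed
qed

section \<open>Polynomials in an operator\<close>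

lemma cblinfun_power_commute: "cblinfun_power K n o\<^sub>C\<^sub>L K = K o\<^sub>C\<^sub>L cblinfun_power K n"
proof (induction n)
  case (Suc n)
  have "cblinfun_apply (cblinfun_power K n) (cblinfun_apply K x) =
      cblinfun_apply K (cblinfun_apply (cblinfun_power K n) x)" for x
    using Suc by (metis cblinfun_compose.rep_eq)
  then show ?case
    by (intro cblinfun_eqI) (simp add: cblinfun_rep_eqs)
qed (simp add: cblinfun_eqI cblinfun_rep_eqs)

lemma cblinfun_apply_sum:
  "cblinfun_apply (\<Sum>i\<in>I. F i) x = (\<Sum>i\<in>I. cblinfun_apply (F i) x)"
  by (induction I rule: infinite_finite_induct) (simp_all add: cblinfun_rep_eqs)

text \<open>Coefficients beyond the degree vanish, so the sum may run to any larger bound. This lets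
  polynomials of different degrees be compared term by term.\<close>

lemma poly_cblinfun_apply:
  assumes "degree p \<le> n"
  shows "cblinfun_apply (poly_cblinfun p K) x =
    (\<Sum>i\<le>n. coeff p i *\<^sub>C cblinfun_apply (cblinfun_power K i) x)"
proof -
  have "(\<Sum>i\<le>n. coeff p i *\<^sub>C cblinfun_apply (cblinfun_power K i) x) =
      (\<Sum>i\<le>degree p. coeff p i *\<^sub>C cblinfun_apply (cblinfun_power K i) x)"
    using assms by (intro sum.mono_neutral_right) (auto simp: coeff_eq_0 scaleC_zero_left)
  then show ?thesis
    by (simp add: poly_cblinfun_def cblinfun_apply_sum cblinfun_rep_eqs)
qed

lemma poly_cblinfun_const: "poly_cblinfun [:c:] K = c *\<^sub>C id_cblinfun"
  by (simp add: poly_cblinfun_def)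

lemma poly_cblinfun_diff: "poly_cblinfun (p - q) K = poly_cblinfun p K - poly_cblinfun q K"
proof (rule cblinfun_eqI)
  fix x
  have *: "(a - b) *\<^sub>C y = a *\<^sub>C y - b *\<^sub>C y" for a b and y :: 'a
    using scaleC_add_left[of "a - b" b y] by simp
  show "cblinfun_apply (poly_cblinfun (p - q) K) x =
      cblinfun_apply (poly_cblinfun p K - poly_cblinfun q K) x"
    by (simp add: cblinfun_rep_eqs * sum_subtractf degree_diff_le
        poly_cblinfun_apply[where n = "max (degree p) (degree q)"])
qed

lemma poly_cblinfun_smult: "poly_cblinfun (smult c p) K = c *\<^sub>C poly_cblinfun p K"
proof (rule cblinfun_eqI)
  fix x
  show "cblinfun_apply (poly_cblinfun (smult c p) K) x =
      cblinfun_apply (c *\<^sub>C poly_cblinfun p K) x"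
    by (simp add: cblinfun_rep_eqs poly_cblinfun_apply[where n = "degree p"] degree_smult_le
        linear_sum[OF bounded_linear.linear[OF bounded_linear_scaleC_right]] scaleC_scaleC
        del: degree_smult_eq)
qed

lemma poly_cblinfun_pCons_0: "poly_cblinfun (pCons 0 p) K = poly_cblinfun p K o\<^sub>C\<^sub>L K"
proof (rule cblinfun_eqI)
  fix x
  \<comment> \<open>Powers are defined with the new factor on the left; here it is moved to the
    right, where it acts on \<open>x\<close> first.\<close>
  have Suc_i: "cblinfun_apply (cblinfun_power K (Suc i)) x =
      cblinfun_apply (cblinfun_power K i) (cblinfun_apply K x)" for i
    using cblinfun_power_commute[of K i] by (metis cblinfun_compose.rep_eq cblinfun_power.simps(2))
  \<comment> \<open>The bound \<open>Suc (degree p)\<close> also covers \<open>p = 0\<close>, where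
    \<open>pCons 0 p\<close> still has degree 0.\<close>
  have "cblinfun_apply (poly_cblinfun (pCons 0 p) K) x =
      (\<Sum>i\<le>Suc (degree p). coeff (pCons 0 p) i *\<^sub>C cblinfun_apply (cblinfun_power K i) x)"
    by (rule poly_cblinfun_apply) (rule degree_pCons_le)
  also have "\<dots> = (\<Sum>i\<le>degree p. coeff p i *\<^sub>C cblinfun_apply (cblinfun_power K i) (cblinfun_apply K x))"
    unfolding sum.atMost_Suc_shift Suc_i by (simp add: scaleC_zero_left)
  also have "\<dots> = cblinfun_apply (poly_cblinfun p K o\<^sub>C\<^sub>L K) x"
    by (simp add: poly_cblinfun_apply[OF order_refl] cblinfun_compose.rep_eq)
  finally show "cblinfun_apply (poly_cblinfun (pCons 0 p) K) x =
      cblinfun_apply (poly_cblinfun p K o\<^sub>C\<^sub>L K) x" .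
qed

text \<open>Multiplication by the variable is \<open>pCons 0\<close>, so the product is a difference
  of two known cases. The linear factor stands on the right so that it acts first on the
  sequence.\<close>

lemma poly_cblinfun_linear_factor:
  "poly_cblinfun ([:- c, 1:] * q) K = poly_cblinfun q K o\<^sub>C\<^sub>L (K - c *\<^sub>C id_cblinfun)"
proof -
  have "[:- c, 1:] * q = pCons 0 q - smult c q"
    by simp
  then show ?thesis
    by (simp add: poly_cblinfun_diff poly_cblinfun_smult poly_cblinfun_pCons_0 cblinfun_eqI
        cblinfun_rep_eqs cblinfun_apply_linear cblinfun_scaleC del: mult_pCons_left)
qed

section \<open>Stability of property (\<beta>) under algebraic perturbation\<close>

text \<open>Asking only that \<open>p(B) f\<^sub>n\<close> tend to zero, instead of
  \<open>p(B) = 0\<close>, makes the induction on the degree work: a proper factor of an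
  annihilating polynomial need not annihilate \<open>B\<close>. The radius is chosen before
  \<open>U\<close> and \<open>f\<close>, so the induction hypothesis can be used for another
  sequence on the same \<open>U\<close>.\<close>

lemma bishop_property_add_poly:
  fixes A B :: "'a::complex_banach \<Rightarrow>\<^sub>C\<^sub>L 'a"
  assumes A: "bishop_property A" and AB: "A o\<^sub>C\<^sub>L B = B o\<^sub>C\<^sub>L A" and "p \<noteq> 0"
  shows "\<exists>v>0. \<forall>U (f :: nat \<Rightarrow> complex \<Rightarrow> 'a).
    open U \<longrightarrow> U \<subseteq> ball z\<^sub>0 v \<longrightarrow> (\<forall>n. f n vector_analytic_on U) \<longrightarrow>
    compactly_tendsto_zero U (\<lambda>n z. cblinfun_apply (A + B - z *\<^sub>C id_cblinfun) (f n z)) \<longrightarrow>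
    compactly_tendsto_zero U (\<lambda>n z. cblinfun_apply (poly_cblinfun p B) (f n z)) \<longrightarrow>
    compactly_tendsto_zero U f"
  using \<open>p \<noteq> 0\<close>
proof (induction "degree p" arbitrary: p)
  case 0
  then obtain c where p: "p = [:c:]" "c \<noteq> 0"
    by (metis degree_eq_zeroE pCons_0_0)
  have one: "1 *\<^sub>C y = y" for y :: 'a
    using scaleR_scaleC[of 1 y] by simp
  \<comment> \<open>Here \<open>p(B)\<close> is the invertible scalar \<open>c\<close>, so applying
    its inverse recovers \<open>f\<close>; any radius will do.\<close>
  have "compactly_tendsto_zero U f"
    if "compactly_tendsto_zero U (\<lambda>n z. cblinfun_apply (poly_cblinfun p B) (f n z))"
    for U and f :: "nat \<Rightarrow> complex \<Rightarrow> 'a"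
    using compactly_tendsto_zero_cblinfun_apply[OF that, of "inverse c *\<^sub>C id_cblinfun"] p
    by (simp add: poly_cblinfun_const cblinfun_rep_eqs scaleC_scaleC one)
  then show ?case
    by (intro exI[of _ 1]) auto
next
  case (Suc d)
  have "\<not> constant (poly p)"
    using Suc.hyps(2) by (simp add: constant_degree)
  then obtain c where "poly p c = 0"
    using fundamental_theorem_of_algebra by blast
  then obtain q where p: "p = [:- c, 1:] * q"
    by (metis poly_eq_0_iff_dvd dvdE)
  with Suc.prems have "q \<noteq> 0"
    by auto
  with p Suc.hyps(2) have "d = degree q"
    by (simp add: degree_mult_eq del: mult_pCons_left)
  from Suc.hyps(1)[OF this \<open>q \<noteq> 0\<close>] obtain v where v: "v > 0"
    and IH: "\<And>U f. \<lbrakk>open U; U \<subseteq> ball z\<^sub>0 v; \<And>n. f n vector_analytic_on U;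
        compactly_tendsto_zero U (\<lambda>n z. cblinfun_apply (A + B - z *\<^sub>C id_cblinfun) (f n z));
        compactly_tendsto_zero U (\<lambda>n z. cblinfun_apply (poly_cblinfun q B) (f n z))\<rbrakk>
      \<Longrightarrow> compactly_tendsto_zero U f"
    by blast
  \<comment> \<open>Property (\<beta>) of \<open>A\<close> at the point \<open>z\<^sub>0 - c\<close>
    is what is translated. The resulting radius \<open>w\<close> depends on the root
    \<open>c\<close>, hence the minimum of \<open>v\<close> and \<open>w\<close> below.\<close>
  have "bishop_property_at (A + c *\<^sub>C id_cblinfun) z\<^sub>0"
    using A by (intro bishop_property_at_translate) (simp add: bishop_property_def)
  then obtain w where w: "w > 0"
    and W: "\<And>U f. \<lbrakk>open U; U \<subseteq> ball z\<^sub>0 w; \<And>n. f n vector_analytic_on U;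
        compactly_tendsto_zero U
          (\<lambda>n z. cblinfun_apply (A + c *\<^sub>C id_cblinfun - z *\<^sub>C id_cblinfun) (f n z))\<rbrakk>
      \<Longrightarrow> compactly_tendsto_zero U f"
    unfolding bishop_property_at_def by blast
  define M where "M = B - c *\<^sub>C id_cblinfun"
  have AB': "cblinfun_apply A (cblinfun_apply B x) = cblinfun_apply B (cblinfun_apply A x)" for x
    using AB by (metis cblinfun_compose.rep_eq)
  show ?case
  proof (intro exI[of _ "min v w"] conjI allI impI)
    show "min v w > 0"
      using v w by simp
    fix U and f :: "nat \<Rightarrow> complex \<Rightarrow> 'a"
    assume U: "open U" "U \<subseteq> ball z\<^sub>0 (min v w)" and f: "\<forall>n. f n vector_analytic_on U"
      and lim: "compactly_tendsto_zero U
        (\<lambda>n z. cblinfun_apply (A + B - z *\<^sub>C id_cblinfun) (f n z))"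
      and limp: "compactly_tendsto_zero U (\<lambda>n z. cblinfun_apply (poly_cblinfun p B) (f n z))"
    have Mf: "compactly_tendsto_zero U (\<lambda>n z. cblinfun_apply M (f n z))"
    proof (rule IH)
      show "U \<subseteq> ball z\<^sub>0 v"
        using U(2) by auto
      show "(\<lambda>z. cblinfun_apply M (f n z)) vector_analytic_on U" for n
        using f by (simp add: vector_analytic_on_cblinfun_apply)
      \<comment> \<open>Since \<open>A\<close> and \<open>B\<close> commute, \<open>M\<close> can be
        pulled to the outside, where boundedness preserves convergence to zero.\<close>
      have "cblinfun_apply (A + B - z *\<^sub>C id_cblinfun) (cblinfun_apply M x) =
          cblinfun_apply M (cblinfun_apply (A + B - z *\<^sub>C id_cblinfun) x)" for x z
        by (simp add: M_def cblinfun_rep_eqs cblinfun_apply_linear cblinfun_scaleC AB'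
            scaleC_diff_right scaleC_add_right scaleC_scaleC mult.commute)
      then show "compactly_tendsto_zero U
          (\<lambda>n z. cblinfun_apply (A + B - z *\<^sub>C id_cblinfun) (cblinfun_apply M (f n z)))"
        using compactly_tendsto_zero_cblinfun_apply[OF lim, of M] by simp
      show "compactly_tendsto_zero U
          (\<lambda>n z. cblinfun_apply (poly_cblinfun q B) (cblinfun_apply M (f n z)))"
        using limp unfolding p poly_cblinfun_linear_factor cblinfun_compose.rep_eq M_def .
    qed (rule U)
    show "compactly_tendsto_zero U f"
    proof (rule W)
      show "U \<subseteq> ball z\<^sub>0 w"
        using U(2) by auto
      \<comment> \<open>Where \<open>M\<close> tends to zero along the sequence, \<open>B\<close>
        acts like the scalar \<open>c\<close>: the residual for \<open>A + c\<close> is the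
        difference of two sequences tending to zero.\<close>
      have eq: "A + c *\<^sub>C id_cblinfun - z *\<^sub>C id_cblinfun = A + B - z *\<^sub>C id_cblinfun - M" for z
        by (simp add: M_def)
      show "compactly_tendsto_zero U
          (\<lambda>n z. cblinfun_apply (A + c *\<^sub>C id_cblinfun - z *\<^sub>C id_cblinfun) (f n z))"
        using compactly_tendsto_zero_diff[OF lim Mf] by (simp only: eq minus_cblinfun.rep_eq)
    qed (use U f in auto)
  qed
qed

theorem bishop_property_add_algebraic:
  assumes "bishop_property A" "algebraic_operator B" "A o\<^sub>C\<^sub>L B = B o\<^sub>C\<^sub>L A"
  shows "bishop_property (A + B)"
  unfolding bishop_property_def bishop_property_at_def
proof
  fix z\<^sub>0
  obtain p where p: "p \<noteq> 0" "poly_cblinfun p B = 0"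
    using assms(2) by (auto simp: algebraic_operator_def)
  \<comment> \<open>An annihilating polynomial makes the extra convergence hypothesis hold for every
    sequence.\<close>
  have zero: "compactly_tendsto_zero U (\<lambda>n z. cblinfun_apply (poly_cblinfun p B) (f n z))"
    for U and f :: "nat \<Rightarrow> complex \<Rightarrow> 'a"
    by (simp add: p(2) zero_cblinfun.rep_eq compactly_tendsto_zero_def uniform_limit_const)
  from bishop_property_add_poly[OF assms(1,3) p(1), of z\<^sub>0] obtain v where "v > 0"
    and v: "\<forall>U (f :: nat \<Rightarrow> complex \<Rightarrow> 'a).
      open U \<longrightarrow> U \<subseteq> ball z\<^sub>0 v \<longrightarrow> (\<forall>n. f n vector_analytic_on U) \<longrightarrow>
      compactly_tendsto_zero U (\<lambda>n z. cblinfun_apply (A + B - z *\<^sub>C id_cblinfun) (f n z)) \<longrightarrow>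
      compactly_tendsto_zero U (\<lambda>n z. cblinfun_apply (poly_cblinfun p B) (f n z)) \<longrightarrow>
      compactly_tendsto_zero U f"
    by (elim exE conjE)
  show "\<exists>v>0. \<forall>U (f :: nat \<Rightarrow> complex \<Rightarrow> 'a).
      open U \<and> U \<subseteq> ball z\<^sub>0 v \<and> (\<forall>n. f n vector_analytic_on U) \<longrightarrow>
      compactly_tendsto_zero U (\<lambda>n z. cblinfun_apply (A + B - z *\<^sub>C id_cblinfun) (f n z)) \<longrightarrow>
      compactly_tendsto_zero U f"
    by (intro exI[of _ v] conjI allI impI \<open>v > 0\<close>; elim conjE)
       (rule v[rule_format]; simp add: zero)
qed

section \<open>Passage to the adjoint\<close>

lemma adjoint_cblinfun_apply2:
  "cblinfun_apply (cblinfun_apply (adjoint_cblinfun T) \<phi>) x = cblinfun_apply \<phi> (cblinfun_apply T x)"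
  by (simp add: adjoint_cblinfun.rep_eq cblinfun_compose.rep_eq)

lemma adjoint_cblinfun_add: "adjoint_cblinfun (S + T) = adjoint_cblinfun S + adjoint_cblinfun T"
  by (intro cblinfun_eqI)
     (simp add: adjoint_cblinfun_apply2 cblinfun_rep_eqs cblinfun_apply_linear)

lemma adjoint_cblinfun_compose:
  "adjoint_cblinfun (S o\<^sub>C\<^sub>L T) = adjoint_cblinfun T o\<^sub>C\<^sub>L adjoint_cblinfun S"
  by (intro cblinfun_eqI) (simp add: adjoint_cblinfun_apply2 cblinfun_rep_eqs)

lemma adjoint_cblinfun_power:
  "adjoint_cblinfun (cblinfun_power K n) = cblinfun_power (adjoint_cblinfun K) n"
proof (induction n)
  case 0
  show ?case
    by (intro cblinfun_eqI) (simp add: adjoint_cblinfun_apply2 cblinfun_rep_eqs)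
next
  case (Suc n)
  \<comment> \<open>The adjoint reverses products, so the new factor lands on the right and has to
    be commuted back to the left.\<close>
  then show ?case
    by (simp add: adjoint_cblinfun_compose cblinfun_power_commute)
qed

text \<open>The Banach space adjoint is complex-linear in the operator, so the coefficients are not
  conjugated. Hence the same polynomial that annihilates \<open>K\<close> annihilates its
  adjoint.\<close>

lemma adjoint_poly_cblinfun:
  "adjoint_cblinfun (poly_cblinfun p K) = poly_cblinfun p (adjoint_cblinfun K)"
  by (intro cblinfun_eqI)
     (simp add: adjoint_cblinfun_apply2 cblinfun_rep_eqs poly_cblinfun_def cblinfun_apply_sum
       cblinfun_scaleC linear_sum[OF bounded_linear.linear[OF bounded_linear_cblinfun]]
       flip: adjoint_cblinfun_power)

lemma algebraic_operator_adjoint: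
  assumes "algebraic_operator K"
  shows "algebraic_operator (adjoint_cblinfun K)"
proof -
  have "adjoint_cblinfun (0 :: 'a \<Rightarrow>\<^sub>C\<^sub>L 'a) = 0"
    by (intro cblinfun_eqI)
       (simp add: adjoint_cblinfun_apply2 cblinfun_rep_eqs cblinfun_apply_linear)
  then show ?thesis
    using assms by (metis algebraic_operator_def adjoint_poly_cblinfun)
qed

theorem corollary2p2:
  fixes T K :: "'a::complex_banach \<Rightarrow>\<^sub>C\<^sub>L 'a"
  assumes "decomposition_property T"
    and "algebraic_operator K"
    and "K o\<^sub>C\<^sub>L T = T o\<^sub>C\<^sub>L K"
  shows "decomposition_property (T + K)"
proof -
  have "bishop_property (adjoint_cblinfun T + adjoint_cblinfun K)"
  proof (rule bishop_property_add_algebraic)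
    show "bishop_property (adjoint_cblinfun T)"
      using assms(1) by (simp add: decomposition_property_def)
    show "algebraic_operator (adjoint_cblinfun K)"
      using assms(2) by (rule algebraic_operator_adjoint)
    \<comment> \<open>Both products are reversed by the adjoint, so the commutation relation
      survives.\<close>
    show "adjoint_cblinfun T o\<^sub>C\<^sub>L adjoint_cblinfun K =
        adjoint_cblinfun K o\<^sub>C\<^sub>L adjoint_cblinfun T"
      by (metis adjoint_cblinfun_compose assms(3))
  qed
  then show ?thesis
    by (simp add: decomposition_property_def adjoint_cblinfun_add)
qed

end
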